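(* Let $\mathbf S=(S,+,\cdot,0,1)$ be a semiring and let $d$ be a derivation on $\mathbf S$. Put $$I_d(S):=\{\emptyset\}\cup\{I_d(x)\mid x\in S\},$$ assume that $$\operatorname{Int}_d(S)\cdot\operatorname{Int}_d(S)\subseteq\operatorname{Int}_d(S),$$ and define binary operations $\oplus$ and $\odot$ on $I_d(S)$ by $$I_d(x)\oplus I_d(y):=I_d(x+y)\ \text{ and }\ I_d(x)\odot I_d(y):=I_d(x\cdot y)\quad\text{if } I_d(x)\neq\emptyset\text{ and }I_d(y)\neq\emptyset,$$ $$z\oplus\emptyset=\emptyset\oplus z:=z\ \text{ and }\ z\odot\emptyset=\emptyset\odot z:=\emptyset$$ for $x,y\in S$ and $z\in I_d(S)$. Then $(I_d(S),\oplus,\odot,\emptyset)$ is a (not necessarily unitary) semiring.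
   Context: A (unitary) semiring is an algebra $\mathbf S=(S,+,\cdot,0,1)$ such that $(S,+,0)$ is a commutative monoid (i.e. $+$ is associative and commutative with neutral element $0$), $(S,\cdot)$ is a semigroup, multiplication distributes over addition from both sides, and $x\cdot 0=0\cdot x=0$ and $x\cdot 1=1\cdot x=x$ for all $x\in S$. A not necessarily unitary semiring $(T,\oplus,\odot,o)$ satisfies the same conditions except those involving the unit $1$ (which is not part of the structure): $(T,\oplus,o)$ is a commutative monoid, $(T,\odot)$ is a semigroup, both distributive laws hold, and $x\odot o=o\odot x=o$ for all $x\in T$. A derivation on $\mathbf S$ is a map $d:S\to S$ with $d(x+y)=d(x)+d(y)$ and $d(x\cdot y)=d(x)\cdot y+x\cdot d(y)$ for all $x,y\in S$. For $b\in S$, $I_d(b):=\{a\in S\mid d(a)=b\}$ is the set of $d$-integrals of $b$, and $\operatorname{Int}_d(S):=\{b\in S\mid I_d(b)\neq\emptyset\}$ is the set of $d$-integrable elements. For subsets $A,B\subseteq S$, $A\cdot B:=\{a\cdot b\mid a\in A,b\in B\}$. *)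

theory Defs
  imports "HOL-Algebra.Coset" "HOL-Algebra.Ring"
begin

(* Unitary semirings are the locale semiring of HOL-Algebra; it does not require the unit to
   differ from zero. *)

definition derivation :: "('a, 'm) ring_scheme \<Rightarrow> ('a \<Rightarrow> 'a) \<Rightarrow> bool" where
  "derivation S d \<longleftrightarrow>
     d \<in> carrier S \<rightarrow> carrier S \<and>
     (\<forall>x\<in>carrier S. \<forall>y\<in>carrier S. d (x \<oplus>\<^bsub>S\<^esub> y) = d x \<oplus>\<^bsub>S\<^esub> d y) \<and>
     (\<forall>x\<in>carrier S. \<forall>y\<in>carrier S.
        d (x \<otimes>\<^bsub>S\<^esub> y) = (d x \<otimes>\<^bsub>S\<^esub> y) \<oplus>\<^bsub>S\<^esub> (x \<otimes>\<^bsub>S\<^esub> d y))"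

definition integrals :: "('a, 'm) ring_scheme \<Rightarrow> ('a \<Rightarrow> 'a) \<Rightarrow> 'a \<Rightarrow> 'a set" where
  "integrals S d b = {a \<in> carrier S. d a = b}"

definition integrable_elems :: "('a, 'm) ring_scheme \<Rightarrow> ('a \<Rightarrow> 'a) \<Rightarrow> 'a set" where
  "integrable_elems S d = {b \<in> carrier S. integrals S d b \<noteq> {}}"

definition integral_sets :: "('a, 'm) ring_scheme \<Rightarrow> ('a \<Rightarrow> 'a) \<Rightarrow> 'a set set" where
  "integral_sets S d = {{}} \<union> {integrals S d x | x. x \<in> carrier S}"

(* The description operator below is justified by the lemmas integral_add_integrals and
   integral_mult_integrals: a nonempty set of integrals determines the element it belongs to,
   so the value does not depend on the chosen representatives. *)

definition integral_add ::
  "('a, 'm) ring_scheme \<Rightarrow> ('a \<Rightarrow> 'a) \<Rightarrow> 'a set \<Rightarrow> 'a set \<Rightarrow> 'a set" where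
  "integral_add S d A B =
     (if A = {} then B else if B = {} then A
      else THE C. \<exists>x\<in>carrier S. \<exists>y\<in>carrier S.
        A = integrals S d x \<and> B = integrals S d y \<and> C = integrals S d (x \<oplus>\<^bsub>S\<^esub> y))"

definition integral_mult ::
  "('a, 'm) ring_scheme \<Rightarrow> ('a \<Rightarrow> 'a) \<Rightarrow> 'a set \<Rightarrow> 'a set \<Rightarrow> 'a set" where
  "integral_mult S d A B =
     (if A = {} \<or> B = {} then {}
      else THE C. \<exists>x\<in>carrier S. \<exists>y\<in>carrier S.
        A = integrals S d x \<and> B = integrals S d y \<and> C = integrals S d (x \<otimes>\<^bsub>S\<^esub> y))"

lemma integrals_inject:
  assumes "integrals S d x = integrals S d x'" and "integrals S d x \<noteq> {}"
  shows "x = x'"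
  using assms unfolding integrals_def by blast

lemma integral_add_integrals:
  assumes "x \<in> carrier S" "y \<in> carrier S"
    and "integrals S d x \<noteq> {}" "integrals S d y \<noteq> {}"
  shows "integral_add S d (integrals S d x) (integrals S d y) = integrals S d (x \<oplus>\<^bsub>S\<^esub> y)"
proof -
  have "(THE C. \<exists>u\<in>carrier S. \<exists>v\<in>carrier S. integrals S d x = integrals S d u \<and>
           integrals S d y = integrals S d v \<and> C = integrals S d (u \<oplus>\<^bsub>S\<^esub> v))
        = integrals S d (x \<oplus>\<^bsub>S\<^esub> y)"
  proof (rule the_equality)
    show "\<exists>u\<in>carrier S. \<exists>v\<in>carrier S. integrals S d x = integrals S d u \<and>
           integrals S d y = integrals S d v \<and>
           integrals S d (x \<oplus>\<^bsub>S\<^esub> y) = integrals S d (u \<oplus>\<^bsub>S\<^esub> v)"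
      using assms by blast
  next
    fix C
    assume "\<exists>u\<in>carrier S. \<exists>v\<in>carrier S. integrals S d x = integrals S d u \<and>
              integrals S d y = integrals S d v \<and> C = integrals S d (u \<oplus>\<^bsub>S\<^esub> v)"
    then obtain u v where "integrals S d x = integrals S d u" "integrals S d y = integrals S d v"
      and C: "C = integrals S d (u \<oplus>\<^bsub>S\<^esub> v)" by blast
    with assms have "x = u" "y = v" by (blast dest: integrals_inject)+
    with C show "C = integrals S d (x \<oplus>\<^bsub>S\<^esub> y)" by simp
  qed
  with assms show ?thesis by (simp add: integral_add_def)
qed

lemma integral_mult_integrals:
  assumes "x \<in> carrier S" "y \<in> carrier S"
    and "integrals S d x \<noteq> {}" "integrals S d y \<noteq> {}"
  shows "integral_mult S d (integrals S d x) (integrals S d y) = integrals S d (x \<otimes>\<^bsub>S\<^esub> y)"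
proof -
  have "(THE C. \<exists>u\<in>carrier S. \<exists>v\<in>carrier S. integrals S d x = integrals S d u \<and>
           integrals S d y = integrals S d v \<and> C = integrals S d (u \<otimes>\<^bsub>S\<^esub> v))
        = integrals S d (x \<otimes>\<^bsub>S\<^esub> y)"
  proof (rule the_equality)
    show "\<exists>u\<in>carrier S. \<exists>v\<in>carrier S. integrals S d x = integrals S d u \<and>
           integrals S d y = integrals S d v \<and>
           integrals S d (x \<otimes>\<^bsub>S\<^esub> y) = integrals S d (u \<otimes>\<^bsub>S\<^esub> v)"
      using assms by blast
  next
    fix C
    assume "\<exists>u\<in>carrier S. \<exists>v\<in>carrier S. integrals S d x = integrals S d u \<and>
              integrals S d y = integrals S d v \<and> C = integrals S d (u \<otimes>\<^bsub>S\<^esub> v)"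
    then obtain u v where "integrals S d x = integrals S d u" "integrals S d y = integrals S d v"
      and C: "C = integrals S d (u \<otimes>\<^bsub>S\<^esub> v)" by blast
    with assms have "x = u" "y = v" by (blast dest: integrals_inject)+
    with C show "C = integrals S d (x \<otimes>\<^bsub>S\<^esub> y)" by simp
  qed
  with assms show ?thesis by (simp add: integral_mult_def)
qed

lemma integral_add_empty:
  "integral_add S d A {} = A" "integral_add S d {} A = A"
  by (simp_all add: integral_add_def)

lemma integral_mult_empty:
  "integral_mult S d A {} = {}" "integral_mult S d {} A = {}"
  by (simp_all add: integral_mult_def)

(* The ring records of HOL-Algebra carry a unit, hence the explicit carrier and operations. *)
locale nonunital_semiring =
  fixes T :: "'b set" and add :: "'b \<Rightarrow> 'b \<Rightarrow> 'b" and mul :: "'b \<Rightarrow> 'b \<Rightarrow> 'b" and zero :: 'b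
  assumes add_comm_monoid: "comm_monoid \<lparr>carrier = T, monoid.mult = add, one = zero\<rparr>"
    and mul_closed: "\<lbrakk> x \<in> T; y \<in> T \<rbrakk> \<Longrightarrow> mul x y \<in> T"
    and mul_assoc: "\<lbrakk> x \<in> T; y \<in> T; z \<in> T \<rbrakk> \<Longrightarrow> mul (mul x y) z = mul x (mul y z)"
    and distrib_right: "\<lbrakk> x \<in> T; y \<in> T; z \<in> T \<rbrakk> \<Longrightarrow> mul (add x y) z = add (mul x z) (mul y z)"
    and distrib_left: "\<lbrakk> x \<in> T; y \<in> T; z \<in> T \<rbrakk> \<Longrightarrow> mul z (add x y) = add (mul z x) (mul z y)"
    and mul_zero_left: "x \<in> T \<Longrightarrow> mul zero x = zero"
    and mul_zero_right: "x \<in> T \<Longrightarrow> mul x zero = zero"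

end

theory Submission
  imports Defs
begin

text \<open>A nonempty set of integrals determines the element it belongs to, so \<open>integrals S d\<close> is a
  bijection from the integrable elements onto the nonempty members of \<open>integral_sets S d\<close>. The
  integrable elements are closed under addition because \<open>d\<close> is additive (a sum of integrals is an
  integral of the sum), and under multiplication by hypothesis; on them, \<open>integral_add\<close> and
  \<open>integral_mult\<close> are therefore the transported operations of the semiring, and the associative,
  commutative and distributive laws carry over. What remains is the empty set, which is adjoined to
  this copy as a new zero: neutral for addition and absorbing for multiplication. Adjoining such an
  element to a structure that satisfies the laws never destroys them: in every law, an empty
  argument either makes both sides empty or reduces them to the same shorter expression.
  So each law is a case distinction on which of its arguments are empty.\<close>

lemma integral_sets_cases:
  assumes "A \<in> integral_sets S d"
  obtains "A = {}" | x where "x \<in> integrable_elems S d" "A = integrals S d x"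
  using assms by (auto simp: integral_sets_def integrable_elems_def)

lemma integrals_in_integral_sets:
  "x \<in> integrable_elems S d \<Longrightarrow> integrals S d x \<in> integral_sets S d"
  by (auto simp: integral_sets_def integrable_elems_def)

lemma integrable_add_closed:
  assumes "semiring S" "derivation S d"
    and "x \<in> integrable_elems S d" "y \<in> integrable_elems S d"
  shows "x \<oplus>\<^bsub>S\<^esub> y \<in> integrable_elems S d"
proof -
  interpret semiring S by fact
  obtain a b where ab: "a \<in> carrier S" "d a = x" "b \<in> carrier S" "d b = y"
    using assms(3,4) by (auto simp: integrable_elems_def integrals_def)
  then have "d (a \<oplus>\<^bsub>S\<^esub> b) = x \<oplus>\<^bsub>S\<^esub> y"
    using assms(2) by (simp add: derivation_def)
  with ab have "a \<oplus>\<^bsub>S\<^esub> b \<in> integrals S d (x \<oplus>\<^bsub>S\<^esub> y)"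
    by (simp add: integrals_def)
  then show ?thesis
    using assms(3,4) by (auto simp: integrable_elems_def)
qed

lemma integral_add_integrable:
  assumes "x \<in> integrable_elems S d" "y \<in> integrable_elems S d"
  shows "integral_add S d (integrals S d x) (integrals S d y) = integrals S d (x \<oplus>\<^bsub>S\<^esub> y)"
  using assms by (simp add: integrable_elems_def integral_add_integrals)

lemma integral_mult_integrable:
  assumes "x \<in> integrable_elems S d" "y \<in> integrable_elems S d"
  shows "integral_mult S d (integrals S d x) (integrals S d y) = integrals S d (x \<otimes>\<^bsub>S\<^esub> y)"
  using assms by (simp add: integrable_elems_def integral_mult_integrals)

theorem theorem16:
  fixes S :: "('a, 'm) ring_scheme" and d :: "'a \<Rightarrow> 'a"
  assumes "semiring S"
    and "derivation S d"
    and "integrable_elems S d <#>\<^bsub>S\<^esub> integrable_elems S d \<subseteq> integrable_elems S d"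
  shows "nonunital_semiring (integral_sets S d) (integral_add S d) (integral_mult S d) {}"
proof -
  interpret semiring S by fact
  have carr: "x \<in> carrier S" if "x \<in> integrable_elems S d" for x
    using that by (simp add: integrable_elems_def)
  have add_cl: "x \<oplus>\<^bsub>S\<^esub> y \<in> integrable_elems S d"
    if "x \<in> integrable_elems S d" "y \<in> integrable_elems S d" for x y
    using integrable_add_closed[OF assms(1,2) that] .
  have mult_cl: "x \<otimes>\<^bsub>S\<^esub> y \<in> integrable_elems S d"
    if "x \<in> integrable_elems S d" "y \<in> integrable_elems S d" for x y
    using that assms(3) by (auto simp: set_mult_def)
  note ops = integral_add_integrable integral_mult_integrable add_cl mult_cl carr
    integral_add_empty integral_mult_empty integrals_in_integral_sets
  have empty: "{} \<in> integral_sets S d"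
    by (simp add: integral_sets_def)
  show ?thesis
  proof (rule nonunital_semiring.intro)
    show "comm_monoid \<lparr>carrier = integral_sets S d, monoid.mult = integral_add S d, one = {}\<rparr>"
    proof (rule comm_monoidI; simp)
      show "{} \<in> integral_sets S d" by (fact empty)
      show "integral_add S d {} A = A" for A by (fact integral_add_empty)
      show "integral_add S d A B \<in> integral_sets S d"
        if "A \<in> integral_sets S d" "B \<in> integral_sets S d" for A B
        using that by (elim integral_sets_cases) (simp_all add: ops empty)
      show "integral_add S d (integral_add S d A B) C = integral_add S d A (integral_add S d B C)"
        if "A \<in> integral_sets S d" "B \<in> integral_sets S d" "C \<in> integral_sets S d" for A B C
        using that by (elim integral_sets_cases) (simp_all add: ops a_assoc)
      show "integral_add S d A B = integral_add S d B A"
        if "A \<in> integral_sets S d" "B \<in> integral_sets S d" for A B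
        using that by (elim integral_sets_cases) (simp_all add: ops a_comm)
    qed
  next
    fix A B assume "A \<in> integral_sets S d" "B \<in> integral_sets S d"
    then show "integral_mult S d A B \<in> integral_sets S d"
      by (elim integral_sets_cases) (simp_all add: ops empty)
  next
    fix A B C assume "A \<in> integral_sets S d" "B \<in> integral_sets S d" "C \<in> integral_sets S d"
    then show "integral_mult S d (integral_mult S d A B) C
        = integral_mult S d A (integral_mult S d B C)"
      by (elim integral_sets_cases) (simp_all add: ops m_assoc)
  next
    fix A B C assume "A \<in> integral_sets S d" "B \<in> integral_sets S d" "C \<in> integral_sets S d"
    then show "integral_mult S d (integral_add S d A B) C
        = integral_add S d (integral_mult S d A C) (integral_mult S d B C)"
      by (elim integral_sets_cases) (simp_all add: ops l_distr)
  next
    fix A B C assume "A \<in> integral_sets S d" "B \<in> integral_sets S d" "C \<in> integral_sets S d"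
    then show "integral_mult S d C (integral_add S d A B)
        = integral_add S d (integral_mult S d C A) (integral_mult S d C B)"
      by (elim integral_sets_cases) (simp_all add: ops r_distr)
  qed (simp_all add: integral_mult_empty)
qed

end
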